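(* Let $M$ be a monoid generated by a set $S$ and let $\mathbf{w}\in S^{\ast}$ be a word of length $\ell(\mathbf{w})$. For a linear extension $e:P(\mathbf{w})\to[\ell(\mathbf{w})]$ of the word poset $P(\mathbf{w})$, let $\mathbf{w}(e)$ be the word of length $\ell(\mathbf{w})$ given by $\mathbf{w}(e)_i=\mathbf{w}_{e^{-1}(i)}$ for $1\le i\le \ell(\mathbf{w})$. Then $e\mapsto \mathbf{w}(e)$ is a bijection from the set of linear extensions of $P(\mathbf{w})$ onto the set of words in the same commutation class as $\mathbf{w}$.
   Context: $S^{\ast}$ is the free monoid of finite words in $S$; $\mathbf{w}_i$ is the $i$-th letter of $\mathbf{w}$ and $\ell(\mathbf{w})$ its length; $[n]=\{1,\dots,n\}$. A monoid $M$ generated by $S$ is a quotient of $S^{\ast}$ by some relations. A relation of the form $ab=ba$ with $a,b\in S$ is called a commutation relation, and then $a$ and $b$ are said to commute. Two words are in the same commutation class if one can be obtained from the other by a finite sequence of commutation relations, i.e. by repeatedly swapping adjacent commuting letters. For a word $\mathbf{w}$, define a relation $\to$ on $[\ell(\mathbf{w})]$ by $i\to j$ iff $i\le j$ and the letters $\mathbf{w}_i,\mathbf{w}_j$ either are equal or do not commute. Let $\leq_{\mathbf{w}}$ be the transitive closure of $\to$; it is a partial order. $P(\mathbf{w})$ denotes the poset $([\ell(\mathbf{w})],\leq_{\mathbf{w}})$ together with the labelling $i\mapsto\mathbf{w}_i$. A linear extension of a finite poset $P$ with $n$ elements is an order-preserving bijection $P\to[n]$, where $[n]$ has its usual order. 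*)

theory Defs
  imports "HOL-Algebra.Group" "HOL-Library.FuncSet"
begin

inductive_set pres_cong :: "'a set \<Rightarrow> ('a list \<times> 'a list) set \<Rightarrow> ('a list \<times> 'a list) set"
  for S :: "'a set" and R :: "('a list \<times> 'a list) set" where
  base: "(u, v) \<in> R \<Longrightarrow> (u, v) \<in> pres_cong S R"
| refl: "u \<in> lists S \<Longrightarrow> (u, u) \<in> pres_cong S R"
| sym: "(u, v) \<in> pres_cong S R \<Longrightarrow> (v, u) \<in> pres_cong S R"
| trans: "(u, v) \<in> pres_cong S R \<Longrightarrow> (v, w) \<in> pres_cong S R \<Longrightarrow> (u, w) \<in> pres_cong S R"
| append: "(u, v) \<in> pres_cong S R \<Longrightarrow> (u', v') \<in> pres_cong S R
    \<Longrightarrow> (u @ u', v @ v') \<in> pres_cong S R"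

definition word_class :: "'a set \<Rightarrow> ('a list \<times> 'a list) set \<Rightarrow> 'a list \<Rightarrow> 'a list set" where
  "word_class S R u = pres_cong S R `` {u}"

definition presented_monoid :: "'a set \<Rightarrow> ('a list \<times> 'a list) set \<Rightarrow> 'a list set monoid" where
  "presented_monoid S R =
    \<lparr>carrier = lists S // pres_cong S R,
     monoid.mult = (\<lambda>A B. \<Union>u\<in>A. \<Union>v\<in>B. word_class S R (u @ v)),
     one = word_class S R []\<rparr>"

text \<open>Two letters commute if the relation \<open>ab = ba\<close> holds in the monoid; it need not be one of
  the relations listed in \<open>R\<close>. In particular every letter commutes with itself.\<close>

definition letters_commute :: "'a set \<Rightarrow> ('a list \<times> 'a list) set \<Rightarrow> 'a \<Rightarrow> 'a \<Rightarrow> bool" where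
  "letters_commute S R a b \<longleftrightarrow>
    word_class S R [a] \<otimes>\<^bsub>presented_monoid S R\<^esub> word_class S R [b] =
    word_class S R [b] \<otimes>\<^bsub>presented_monoid S R\<^esub> word_class S R [a]"

definition commutation_step :: "'a set \<Rightarrow> ('a list \<times> 'a list) set \<Rightarrow> ('a list \<times> 'a list) set" where
  "commutation_step S R =
    {(u @ [a, b] @ v, u @ [b, a] @ v) | u a b v.
      u \<in> lists S \<and> v \<in> lists S \<and> a \<in> S \<and> b \<in> S \<and> letters_commute S R a b}"

definition commutation_class :: "'a set \<Rightarrow> ('a list \<times> 'a list) set \<Rightarrow> 'a list \<Rightarrow> 'a list set" where
  "commutation_class S R w = (commutation_step S R)\<^sup>* `` {w}"

text \<open>Positions in a word are numbered from 1.\<close>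

definition letter :: "'a list \<Rightarrow> nat \<Rightarrow> 'a" where
  "letter w i = w ! (i - 1)"

definition word_arrow :: "'a set \<Rightarrow> ('a list \<times> 'a list) set \<Rightarrow> 'a list \<Rightarrow> (nat \<times> nat) set" where
  "word_arrow S R w =
    {(i, j). i \<in> {1..length w} \<and> j \<in> {1..length w} \<and> i \<le> j \<and>
      (letter w i = letter w j \<or> \<not> letters_commute S R (letter w i) (letter w j))}"

definition word_order :: "'a set \<Rightarrow> ('a list \<times> 'a list) set \<Rightarrow> 'a list \<Rightarrow> (nat \<times> nat) set" where
  "word_order S R w = (word_arrow S R w)\<^sup>+"

text \<open>Linear extensions of the finite poset \<open>(A, r)\<close>. They are taken to be extensional, so that
  two of them are equal as soon as they agree on \<open>A\<close>.\<close>

definition linear_extensions :: "'b set \<Rightarrow> ('b \<times> 'b) set \<Rightarrow> ('b \<Rightarrow> nat) set" where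
  "linear_extensions A r =
    {e \<in> A \<rightarrow>\<^sub>E {1..card A}. bij_betw e A {1..card A} \<and> (\<forall>(x, y)\<in>r. e x \<le> e y)}"

definition extension_word :: "'a list \<Rightarrow> (nat \<Rightarrow> nat) \<Rightarrow> 'a list" where
  "extension_word w e =
    map (\<lambda>i. letter w (inv_into {1..length w} e i)) [1..<Suc (length w)]"

lemma pres_cong_lists:
  assumes "R \<subseteq> lists S \<times> lists S" and "(u, v) \<in> pres_cong S R"
  shows "u \<in> lists S \<and> v \<in> lists S"
  using assms(2) by induction (use assms(1) in auto)

lemma equiv_pres_cong:
  assumes "R \<subseteq> lists S \<times> lists S"
  shows "equiv (lists S) (pres_cong S R)"
proof (rule equivI)
  show "pres_cong S R \<subseteq> lists S \<times> lists S"
    using pres_cong_lists[OF assms] by auto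
  show "refl_on (lists S) (pres_cong S R)"
    by (rule refl_onI) (rule pres_cong.refl)
  show "sym (pres_cong S R)" by (rule symI) (rule pres_cong.sym)
  show "trans (pres_cong S R)" by (rule transI) (rule pres_cong.trans)
qed

lemma word_class_mult:
  assumes "R \<subseteq> lists S \<times> lists S" and "u \<in> lists S" and "v \<in> lists S"
  shows "word_class S R u \<otimes>\<^bsub>presented_monoid S R\<^esub> word_class S R v = word_class S R (u @ v)"
proof -
  have eq: "word_class S R (u' @ v') = word_class S R (u @ v)"
    if "u' \<in> word_class S R u" "v' \<in> word_class S R v" for u' v'
  proof -
    have "(u @ v, u' @ v') \<in> pres_cong S R"
      using that by (intro pres_cong.append) (simp_all add: word_class_def)
    from equiv_class_eq[OF equiv_pres_cong[OF assms(1)] this] show ?thesis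
      by (simp add: word_class_def)
  qed
  have "u \<in> word_class S R u" "v \<in> word_class S R v"
    using assms by (simp_all add: word_class_def pres_cong.refl)
  then have "(\<Union>u'\<in>word_class S R u. \<Union>v'\<in>word_class S R v. word_class S R (u' @ v')) =
      word_class S R (u @ v)"
    using eq by blast
  then show ?thesis by (simp add: presented_monoid_def)
qed

lemma monoid_presented_monoid:
  assumes R: "R \<subseteq> lists S \<times> lists S"
  shows "monoid (presented_monoid S R)"
proof -
  have carr: "x \<in> carrier (presented_monoid S R) \<longleftrightarrow> (\<exists>u\<in>lists S. x = word_class S R u)" for x
    by (auto simp: presented_monoid_def quotient_def word_class_def)
  have one: "\<one>\<^bsub>presented_monoid S R\<^esub> = word_class S R []"
    by (simp add: presented_monoid_def)
  show ?thesis
  proof (rule monoidI)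
    fix x y assume "x \<in> carrier (presented_monoid S R)" "y \<in> carrier (presented_monoid S R)"
    then obtain u v where "u \<in> lists S" "v \<in> lists S" "x = word_class S R u" "y = word_class S R v"
      by (auto simp: carr)
    then show "x \<otimes>\<^bsub>presented_monoid S R\<^esub> y \<in> carrier (presented_monoid S R)"
      unfolding carr by (intro bexI[of _ "u @ v"]) (simp_all add: word_class_mult[OF R])
  next
    show "\<one>\<^bsub>presented_monoid S R\<^esub> \<in> carrier (presented_monoid S R)"
      unfolding carr one by (intro bexI[of _ "[]"]) auto
  next
    fix x y z
    assume "x \<in> carrier (presented_monoid S R)" "y \<in> carrier (presented_monoid S R)"
      "z \<in> carrier (presented_monoid S R)"
    then obtain u v w where "u \<in> lists S" "v \<in> lists S" "w \<in> lists S"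
      "x = word_class S R u" "y = word_class S R v" "z = word_class S R w"
      unfolding carr by blast
    then show "x \<otimes>\<^bsub>presented_monoid S R\<^esub> y \<otimes>\<^bsub>presented_monoid S R\<^esub> z =
        x \<otimes>\<^bsub>presented_monoid S R\<^esub> (y \<otimes>\<^bsub>presented_monoid S R\<^esub> z)"
      using R by (simp add: word_class_mult)
  next
    fix x assume "x \<in> carrier (presented_monoid S R)"
    then obtain u where u: "u \<in> lists S" "x = word_class S R u" by (auto simp: carr)
    show "\<one>\<^bsub>presented_monoid S R\<^esub> \<otimes>\<^bsub>presented_monoid S R\<^esub> x = x"
      using u word_class_mult[OF R, of "[]" u] by (simp add: one)
    show "x \<otimes>\<^bsub>presented_monoid S R\<^esub> \<one>\<^bsub>presented_monoid S R\<^esub> = x"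
      using u word_class_mult[OF R, of u "[]"] by (simp add: one)
  qed
qed

lemma word_order_le:
  assumes "(i, j) \<in> word_order S R w"
  shows "i \<le> j \<and> i \<in> {1..length w} \<and> j \<in> {1..length w}"
  using assms unfolding word_order_def by induction (auto simp: word_arrow_def)

lemma partial_order_on_word_order:
  "partial_order_on {1..length w} (word_order S R w)"
proof -
  have "word_order S R w \<subseteq> {1..length w} \<times> {1..length w}"
    by (auto dest: word_order_le)
  moreover have "refl_on {1..length w} (word_order S R w)"
    unfolding word_order_def by (rule refl_onI) (auto simp: word_arrow_def)
  moreover have "antisym (word_order S R w)"
    by (rule antisymI) (meson word_order_le le_antisym)
  moreover have "trans (word_order S R w)"
    unfolding word_order_def by (rule trans_trancl)
  ultimately show ?thesis
    by (simp add: partial_order_on_def preorder_on_def)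
qed

end

theory Submission
  imports Defs "HOL-Combinatorics.Transposition"
begin

text \<open>A linear extension is determined by its word because occurrences of the same letter keep
  their relative order. If a linear extension places two distinct commuting letters in consecutive
  positions \<open>k\<close> and \<open>k + 1\<close>, then exchanging the values \<open>k\<close> and \<open>k + 1\<close> yields another one, whose
  word differs by one commutation step. Hence the words obtained are closed under commutation
  steps. Conversely, any linear extension other than the identity has a descent
  \<open>e q = k\<close>, \<open>e p = k + 1\<close> with \<open>p < q\<close>; the letters there must be distinct and commute, and
  exchanging them decreases \<open>\<Sum>i. i * (n - e i)\<close>, so finitely many steps lead back to the
  identity.\<close>

section \<open>Linear extensions, their words, and injectivity\<close>

lemma letters_commute_sym: "letters_commute S R a b \<longleftrightarrow> letters_commute S R b a"
  unfolding letters_commute_def by (rule eq_commute)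

text \<open>Monotonicity along \<open>r\<close> propagates along chains, so order preservation need
  only be checked on single arrows.\<close>

lemma linear_extensions_trancl:
  "linear_extensions A (r\<^sup>+) = linear_extensions A r"
proof -
  have "(\<forall>(x, y)\<in>r\<^sup>+. e x \<le> e y) \<longleftrightarrow> (\<forall>(x, y)\<in>r. e x \<le> e y)" for e :: "'a \<Rightarrow> nat"
  proof
    assume *: "\<forall>(x, y)\<in>r. e x \<le> e y"
    have "e x \<le> e y" if "(x, y) \<in> r\<^sup>+" for x y
      using that by induction (use * in fastforce)+
    then show "\<forall>(x, y)\<in>r\<^sup>+. e x \<le> e y" by blast
  qed blast
  then show ?thesis by (simp add: linear_extensions_def)
qed

lemma linear_extensions_word_order_iff:
  "e \<in> linear_extensions {1..length w} (word_order S R w) \<longleftrightarrow>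
    e \<in> extensional {1..length w} \<and> bij_betw e {1..length w} {1..length w} \<and>
    (\<forall>i\<in>{1..length w}. \<forall>j\<in>{1..length w}. i \<le> j \<longrightarrow>
      letter w i = letter w j \<or> \<not> letters_commute S R (letter w i) (letter w j) \<longrightarrow> e i \<le> e j)"
proof -
  have "e \<in> {1..length w} \<rightarrow>\<^sub>E {1..length w} \<longleftrightarrow> e \<in> extensional {1..length w}"
    if "bij_betw e {1..length w} {1..length w}"
    using bij_betw_imp_funcset[OF that] by (simp add: PiE_def)
  then show ?thesis
    unfolding word_order_def linear_extensions_trancl
    unfolding linear_extensions_def word_arrow_def card_atLeastAtMost diff_Suc_1 by blast
qed

text \<open>Reindexing by \<open>k = e i\<close> removes the inverse: \<open>e\<close> carries each
  letter of \<open>w\<close> from position \<open>i\<close> to position \<open>e i\<close>. All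
  later arguments use this form.\<close>

lemma extension_word_eq_iff:
  assumes e: "bij_betw e {1..length w} {1..length w}"
  shows "extension_word w e = v \<longleftrightarrow>
    length v = length w \<and> (\<forall>i\<in>{1..length w}. letter v (e i) = letter w i)"
proof -
  let ?g = "inv_into {1..length w} e"
  have "extension_word w e = v \<longleftrightarrow>
      length v = length w \<and> (\<forall>k<length w. letter w (?g (Suc k)) = v ! k)"
    unfolding list_eq_iff_nth_eq
    by (simp add: extension_word_def eq_commute[of _ "length v"] del: upt_Suc)
  also have "(\<forall>k<length w. letter w (?g (Suc k)) = v ! k) \<longleftrightarrow>
      (\<forall>k\<in>{1..length w}. letter w (?g k) = letter v k)"
  proof -
    have "{1..length w} = Suc ` {..<length w}"
      by (simp add: image_Suc_lessThan)
    then show ?thesis by (auto simp: letter_def)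
  qed
  also have "\<dots> \<longleftrightarrow> (\<forall>k\<in>e ` {1..length w}. letter w (?g k) = letter v k)"
    using e by (simp add: bij_betw_def)
  also have "\<dots> \<longleftrightarrow> (\<forall>i\<in>{1..length w}. letter v (e i) = letter w i)"
    unfolding ball_simps using inv_into_f_f[OF bij_betw_imp_inj_on[OF e]]
    by (metis (no_types, lifting))
  finally show ?thesis .
qed

text \<open>Strong induction on positions. If the extensions agree before \<open>i\<close> but
  differ at \<open>i\<close>, the smaller of the two values is taken by the other extension at some
  \<open>j\<close> with the same letter. Equal letters keep their order, so \<open>j < i\<close>,
  and agreement at \<open>j\<close> contradicts injectivity.\<close>

lemma inj_on_extension_word:
  "inj_on (extension_word w) (linear_extensions {1..length w} (word_order S R w))"
proof (rule inj_onI)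
  let ?A = "{1..length w}" and ?L = "linear_extensions {1..length w} (word_order S R w)"
  fix e f assume ef: "e \<in> ?L" "f \<in> ?L" and eq: "extension_word w e = extension_word w f"
  note L = ef[unfolded linear_extensions_word_order_iff]
  define v where "v = extension_word w f"
  have v: "letter v (e i) = letter w i" "letter v (f i) = letter w i" if "i \<in> ?A" for i
    using extension_word_eq_iff[of e w v] extension_word_eq_iff[of f w v] L eq that
    by (auto simp: v_def)
  \<comment> \<open>Stated for arbitrary \<open>g\<close> and \<open>h\<close> so that it applies to
    \<open>e\<close> and \<open>f\<close> in both orders.\<close>
  have not_less: "\<not> g i < h i"
    if gh: "g \<in> ?L" "h \<in> ?L" and i: "i \<in> ?A" and IH: "\<And>j. j < i \<Longrightarrow> j \<in> ?A \<Longrightarrow> g j = h j"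
      and vg: "\<And>j. j \<in> ?A \<Longrightarrow> letter v (g j) = letter w j"
      and vh: "\<And>j. j \<in> ?A \<Longrightarrow> letter v (h j) = letter w j" for g h i
  proof
    assume less: "g i < h i"
    note gh = gh[unfolded linear_extensions_word_order_iff]
    obtain j where j: "j \<in> ?A" "h j = g i"
      using gh i by (metis bij_betw_imp_surj_on imageE imageI)
    then have "letter w i = letter w j" using vg[OF i] vh[of j] by simp
    then have "j < i" using gh(2) i j less by (metis leD not_le_imp_less)
    then have "g j = g i" using IH j by simp
    then show False using gh(1) i j \<open>j < i\<close> by (auto simp: bij_betw_def dest: inj_onD)
  qed
  have "e i = f i" if "i \<in> ?A" for i
    using that
  proof (induction i rule: less_induct)
    case (less i)
    then show ?case using not_less[of e f i] not_less[of f e i] ef v by fastforce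
  qed
  then show "e = f" using L by (meson extensionalityI)
qed

section \<open>Commutation steps as exchanges of consecutive values\<close>

lemma letter_swap:
  assumes "k \<ge> 1"
  shows "letter (u @ [b, a] @ x) (transpose (length u + 1) (length u + 2) k) =
    letter (u @ [a, b] @ x) k"
proof -
  \<comment> \<open>At \<open>k = 0\<close> the claim could fail for empty \<open>u\<close>:
    truncated subtraction makes \<open>letter\<close> read the head, while the transposition fixes
    \<open>0\<close>.\<close>
  consider "k \<le> length u" | "k = length u + 1" | "k = length u + 2" | "k > length u + 2"
    by linarith
  then show ?thesis
    using assms
    by cases (auto simp: letter_def nth_append transpose_def nth_Cons' less_diff_conv2)
qed

lemma linear_extension_swap:
  fixes w u x :: "'a list" and a b :: 'a
  defines "\<tau> \<equiv> transpose (length u + 1) (length u + 2)"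
  assumes e: "e \<in> linear_extensions {1..length w} (word_order S R w)"
    and word: "extension_word w e = u @ [a, b] @ x"
    and ab: "a \<noteq> b" "letters_commute S R a b"
  shows "restrict (\<tau> \<circ> e) {1..length w} \<in> linear_extensions {1..length w} (word_order S R w)"
    and "extension_word w (restrict (\<tau> \<circ> e) {1..length w}) = u @ [b, a] @ x"
proof -
  let ?A = "{1..length w}" and ?e' = "restrict (\<tau> \<circ> e) {1..length w}"
  note L = e[unfolded linear_extensions_word_order_iff]
  have len: "length w = length u + 2 + length x"
    and v: "\<And>i. i \<in> ?A \<Longrightarrow> letter (u @ [a, b] @ x) (e i) = letter w i"
    using extension_word_eq_iff[of e w "u @ [a, b] @ x"] L word by auto
  have "bij_betw \<tau> ?A ?A"
    unfolding \<tau>_def by (rule bij_betw_transpose_iff) (auto simp: len)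
  then have bij: "bij_betw ?e' ?A ?A"
    using L by (intro bij_betw_restrict_eq[THEN iffD2] bij_betw_trans[of e]) auto
  have "?e' i \<le> ?e' j"
    if ij: "i \<in> ?A" "j \<in> ?A" "i \<le> j"
      and dep: "letter w i = letter w j \<or> \<not> letters_commute S R (letter w i) (letter w j)"
    for i j
  proof -
    have "e i \<le> e j" using L ij dep by blast
    \<comment> \<open>Exchanging two consecutive values reverses only the comparison between those
      two values.\<close>
    moreover have "\<not> (e i = length u + 1 \<and> e j = length u + 2)"
    proof
      assume "e i = length u + 1 \<and> e j = length u + 2"
      then have "letter w i = a" "letter w j = b"
        using v[of i] v[of j] ij by (auto simp: letter_def nth_append)
      then show False using dep ab by simp
    qed
    ultimately show ?thesis using ij by (auto simp: \<tau>_def transpose_def)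
  qed
  then show "?e' \<in> linear_extensions ?A (word_order S R w)"
    unfolding linear_extensions_word_order_iff using bij by blast
  have "letter (u @ [b, a] @ x) (?e' i) = letter w i" if "i \<in> ?A" for i
  proof -
    have "e i \<ge> 1" using L that by (meson atLeastAtMost_iff bij_betwE)
    then show ?thesis using letter_swap[of "e i" u b a x] v[OF that] that by (simp add: \<tau>_def)
  qed
  then show "extension_word w ?e' = u @ [b, a] @ x"
    using extension_word_eq_iff[OF bij] len by simp
qed

lemma restrict_id_linear_extension:
  "restrict id {1..length w} \<in> linear_extensions {1..length w} (word_order S R w)"
  "extension_word w (restrict id {1..length w}) = w"
proof -
  have bij: "bij_betw (restrict id {1..length w}) {1..length w} {1..length w}"
    by (simp add: bij_betw_restrict_eq)
  then show "restrict id {1..length w} \<in> linear_extensions {1..length w} (word_order S R w)"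
    unfolding linear_extensions_word_order_iff by simp
  show "extension_word w (restrict id {1..length w}) = w"
    using extension_word_eq_iff[OF bij, of w] by simp
qed

lemma commutation_class_subset_extension_words:
  "commutation_class S R w \<subseteq>
    extension_word w ` linear_extensions {1..length w} (word_order S R w)"
proof
  let ?I = "extension_word w ` linear_extensions {1..length w} (word_order S R w)"
  fix v assume "v \<in> commutation_class S R w"
  then have "(w, v) \<in> (commutation_step S R)\<^sup>*" by (simp add: commutation_class_def)
  then show "v \<in> ?I"
  proof induction
    case base
    show ?case using restrict_id_linear_extension by (metis imageI)
  next
    case (step y z)
    then obtain e where e: "e \<in> linear_extensions {1..length w} (word_order S R w)"
      "extension_word w e = y" by blast
    obtain u a b x where yz: "y = u @ [a, b] @ x" "z = u @ [b, a] @ x" "letters_commute S R a b"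
      using step.hyps(2) unfolding commutation_step_def by blast
    show ?case
    \<comment> \<open>A letter commutes with itself, so a step may exchange equal letters; it then
      leaves the word unchanged.\<close>
    proof (cases "a = b")
      case True
      then show ?thesis using step.IH yz by simp
    next
      case False
      then show ?thesis using linear_extension_swap[OF e(1), of u a b x] e(2) yz by (metis imageI)
    qed
  qed
qed

section \<open>Descents and the return to the identity\<close>

lemma bij_betw_ascending_imp_id:
  fixes g :: "nat \<Rightarrow> nat"
  assumes bij: "bij_betw g {1..n} {1..n}"
    and asc: "\<And>k. 1 \<le> k \<Longrightarrow> k < n \<Longrightarrow> g k < g (Suc k)"
    and k: "k \<in> {1..n}"
  shows "g k = k"
proof (rule antisym)
  have range: "g k \<in> {1..n}" if "k \<in> {1..n}" for k
    using bij that by (meson bij_betwE)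
  have "1 \<le> k" "k \<le> n" using k by auto
  then show "k \<le> g k"
  proof (induction k rule: dec_induct)
    case base
    then show ?case using range[of 1] by simp
  next
    case (step m)
    then show ?case using asc[of m] by simp
  qed
  show "g k \<le> k"
    using \<open>k \<le> n\<close> \<open>1 \<le> k\<close>
  proof (induction k rule: inc_induct)
    case base
    then show ?case using range[of n] by simp
  next
    case (step m)
    then show ?case using asc[of m] by simp
  qed
qed

text \<open>An inverse that ascends everywhere is the identity, and then so is \<open>e\<close>.
  Hence the inverse drops between some \<open>k\<close> and \<open>k + 1\<close>, and its values
  there are \<open>q\<close> and \<open>p\<close>.\<close>

lemma bij_betw_descent:
  fixes e :: "nat \<Rightarrow> nat"
  assumes bij: "bij_betw e {1..n} {1..n}" and "\<exists>i\<in>{1..n}. e i \<noteq> i"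
  obtains p q where "p \<in> {1..n}" "q \<in> {1..n}" "p < q" "e p = Suc (e q)"
proof -
  let ?g = "inv_into {1..n} e"
  have g: "bij_betw ?g {1..n} {1..n}" using bij by (rule bij_betw_inv_into)
  have "\<exists>k. 1 \<le> k \<and> k < n \<and> \<not> ?g k < ?g (Suc k)"
  proof (rule ccontr)
    assume "\<not> ?thesis"
    then have "?g k = k" if "k \<in> {1..n}" for k
      using bij_betw_ascending_imp_id[OF g] that by blast
    then have "e i = i" if "i \<in> {1..n}" for i
      using bij that by (metis bij_betw_inv_into_right)
    then show False using assms(2) by blast
  qed
  then obtain k where k: "k \<in> {1..n}" "Suc k \<in> {1..n}" "\<not> ?g k < ?g (Suc k)" by auto
  have "?g k \<noteq> ?g (Suc k)"
    using g k by (metis bij_betw_imp_inj_on inj_onD n_not_Suc_n)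
  then show thesis
    using k that[of "?g (Suc k)" "?g k"] bij_betwE[OF g] bij_betw_inv_into_right[OF bij]
    by (metis linorder_neqE_nat)
qed

text \<open>The termination measure. Only the terms at \<open>p\<close> and \<open>q\<close> change:
  with \<open>d = n - e p\<close>, their sum goes from \<open>p * d + q * (d + 1)\<close> to
  \<open>p * (d + 1) + q * d\<close>, a drop of \<open>q - p\<close>.\<close>

lemma sum_mult_diff_swap_less:
  fixes e :: "nat \<Rightarrow> nat"
  assumes inj: "inj_on e {1..n}" and le: "\<And>i. i \<in> {1..n} \<Longrightarrow> e i \<le> n"
    and pq: "p \<in> {1..n}" "q \<in> {1..n}" "p < q" "e p = Suc (e q)"
  shows "(\<Sum>i\<in>{1..n}. i * (n - transpose (e q) (e p) (e i))) < (\<Sum>i\<in>{1..n}. i * (n - e i))"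
proof -
  have split: "sum f {1..n} = f p + (f q + sum f ({1..n} - {p} - {q}))" for f :: "nat \<Rightarrow> nat"
    using pq sum.remove[of "{1..n}" p f] sum.remove[of "{1..n} - {p}" q f] by simp
  have rest: "transpose (e q) (e p) (e i) = e i" if "i \<in> {1..n} - {p} - {q}" for i
  proof (rule transpose_apply_other)
    show "e i \<noteq> e q" "e i \<noteq> e p" using that pq inj by (metis DiffE inj_onD insertI1)+
  qed
  obtain d where d: "n - e q = Suc d" "n - e p = d"
    using le[OF pq(1)] pq(4) by (metis Suc_diff_Suc Suc_le_lessD)
  show ?thesis
    unfolding split by (simp add: rest d pq(3))
qed

lemma extension_word_in_commutation_class:
  assumes "w \<in> lists S" and "e \<in> linear_extensions {1..length w} (word_order S R w)"
  shows "extension_word w e \<in> commutation_class S R w"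
  using assms(2)
proof (induction "\<Sum>i\<in>{1..length w}. i * (length w - e i)" arbitrary: e rule: less_induct)
  case less
  let ?A = "{1..length w}" and ?v = "extension_word w e"
  note L = less.prems[unfolded linear_extensions_word_order_iff]
  show ?case
  proof (cases "\<exists>i\<in>?A. e i \<noteq> i")
    case False
    then have "e = restrict id ?A"
      using L by (intro extensionalityI[of _ ?A]) auto
    then show ?thesis
      using restrict_id_linear_extension(2)[of w] by (simp add: commutation_class_def)
  next
    case True
    then obtain p q where pq: "p \<in> ?A" "q \<in> ?A" "p < q" "e p = Suc (e q)"
      using L bij_betw_descent by metis
    have range: "e i \<in> ?A" if "i \<in> ?A" for i using L that by (meson bij_betwE)
    have v: "length ?v = length w" "\<And>i. i \<in> ?A \<Longrightarrow> letter ?v (e i) = letter w i"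
      using extension_word_eq_iff[of e w ?v] L by auto
    \<comment> \<open>\<open>commutation_step\<close> demands that the context and both letters lie
      over \<open>S\<close>; every letter of \<open>?v\<close> occurs in \<open>w\<close>.\<close>
    have "set ?v \<subseteq> S"
    proof
      fix c assume "c \<in> set ?v"
      then obtain i where "i < length w" "c = ?v ! i" by (metis in_set_conv_nth v(1))
      then have "Suc i \<in> ?A" "c = letter ?v (Suc i)" by (auto simp: letter_def)
      moreover then obtain j where "j \<in> ?A" "e j = Suc i"
        using L by (metis bij_betw_imp_surj_on imageE)
      ultimately have "c = w ! (j - 1)" "j - 1 < length w"
        using v(2)[of j] by (auto simp: letter_def)
      then show "c \<in> S" using assms(1) by auto
    qed
    \<comment> \<open>These are the parts of \<open>?v\<close> before and after the adjacent
      positions \<open>e q\<close> and \<open>e p = e q + 1\<close>, counted from 1.\<close>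
    define u x where "u = take (e q - 1) ?v" and "x = drop (e p) ?v"
    have len: "length u + 1 = e q" "length u + 2 = e p"
      using range[OF pq(1)] range[OF pq(2)] pq(4) v(1) by (auto simp: u_def)
    have word: "?v = u @ [letter w q, letter w p] @ x"
    proof -
      have "?v = u @ ?v ! (e q - 1) # drop (e q) ?v"
        using range[OF pq(2)] v(1) id_take_nth_drop[of "e q - 1" ?v]
        by (simp add: u_def Suc_le_eq less_diff_conv2)
      also have "drop (e q) ?v = ?v ! (e p - 1) # x"
        using range[OF pq(1)] pq(4) v(1) Cons_nth_drop_Suc[of "e q" ?v] by (simp add: x_def)
      finally show ?thesis
        using v(2)[OF pq(1)] v(2)[OF pq(2)] by (simp add: letter_def)
    qed
    \<comment> \<open>Otherwise there would be an arrow from \<open>p\<close> to \<open>q\<close>,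
      forcing \<open>e p \<le> e q\<close>.\<close>
    have comm: "letter w q \<noteq> letter w p" "letters_commute S R (letter w q) (letter w p)"
      using L pq letters_commute_sym by (metis less_or_eq_imp_le not_less_eq_eq order_refl)+
    let ?e' = "restrict (transpose (e q) (e p) \<circ> e) ?A"
    have e': "?e' \<in> linear_extensions ?A (word_order S R w)"
      "extension_word w ?e' = u @ [letter w p, letter w q] @ x"
      using linear_extension_swap[OF less.prems word comm] unfolding len by blast+
    have "(\<Sum>i\<in>?A. i * (length w - ?e' i)) < (\<Sum>i\<in>?A. i * (length w - e i))"
      using sum_mult_diff_swap_less[of e "length w" p q] L range pq by (simp add: bij_betw_def)
    then have "extension_word w ?e' \<in> commutation_class S R w"
      using less.hyps e'(1) by blast
    \<comment> \<open>The step runs from the new word, already in the class by induction, back to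
      \<open>?v\<close>.\<close>
    moreover have "(extension_word w ?e', ?v) \<in> commutation_step S R"
    proof -
      have "u \<in> lists S" "x \<in> lists S" "letter w q \<in> S" "letter w p \<in> S"
        using \<open>set ?v \<subseteq> S\<close> by (subst (asm) word, auto)+
      then show ?thesis
        unfolding commutation_step_def e'(2)
        using comm(2)[unfolded letters_commute_sym[of S R "letter w q"]] word by blast
    qed
    ultimately show ?thesis
      unfolding commutation_class_def by (simp add: rtrancl.rtrancl_into_rtrancl)
  qed
qed

theorem theorem1p1:
  fixes S :: "'a set" and R :: "('a list \<times> 'a list) set" and w :: "'a list"
  assumes "R \<subseteq> lists S \<times> lists S"
    and "w \<in> lists S"
  shows "bij_betw (extension_word w)
    (linear_extensions {1..length w} (word_order S R w))
    (commutation_class S R w)"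
  unfolding bij_betw_def
  using inj_on_extension_word commutation_class_subset_extension_words
    extension_word_in_commutation_class[OF assms(2)]
  by blast

end
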